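(* Let $N, M \ge 1$, let $A \in \mathbb{R}^{N\times N}$, $B \in \mathbb{R}^{N\times M}$, $C \in \mathbb{R}^{M\times N}$, $D \in \mathbb{R}^{M\times M}$, and let $m = [m_1,\dots,m_N]$ be a vector of positive integer delays. Consider the feedback delay network (FDN) with transfer function $H(z) = C\,(\Delta_m(z^{-1}) - A)^{-1} B + D$, where $\Delta_m(z^{-1}) = \operatorname{diag}(z^{m_1},\dots,z^{m_N})$. If there exists a non-singular diagonal matrix $T$ of size $N \times N$ such that $\lVert T^{-1} A T\rVert < 1$, then the FDN is stable.
   Context: $\lVert\cdot\rVert$ denotes the operator norm of a matrix. Matrices have real entries. The system poles of the FDN are the roots of the generalized characteristic polynomial $p_{m,A}(z) = \det(\operatorname{diag}(z^{m_1},\dots,z^{m_N}) - A)$, a polynomial of degree $m_1+\dots+m_N$. The FDN is called stable if all its system poles lie (strictly) inside the unit circle. *)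

theory Defs
  imports "HOL-Analysis.Analysis"
begin

definition diag :: "'a::zero ^ 'n \<Rightarrow> 'a ^ 'n ^ 'n" where
  "diag d = (\<chi> i j. if i = j then d $ i else 0)"

definition diagonal_matrix :: "'a::zero ^ 'n ^ 'n \<Rightarrow> bool" where
  "diagonal_matrix X \<longleftrightarrow> (\<exists>d. X = diag d)"

text \<open>The norm induced by the Euclidean norms; the type-class \<open>norm\<close> on matrices is the
  Frobenius norm instead.\<close>

abbreviation op_norm :: "real ^ 'n ^ 'm \<Rightarrow> real" where
  "op_norm X \<equiv> onorm ((*v) X)"

text \<open>A feedback delay network with \<open>N = CARD('n)\<close> delay lines and \<open>M = CARD('m)\<close> inputs and
  outputs. Positivity of the delays is not part of the record.\<close>

record ('n::finite, 'm::finite) fdn =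
  delays :: "nat ^ 'n"
  feedback :: "real ^ 'n ^ 'n"
  input_gain :: "real ^ 'm ^ 'n"
  output_gain :: "real ^ 'n ^ 'm"
  direct_gain :: "real ^ 'm ^ 'm"

text \<open>\<open>delay_matrix m z\<close> is the matrix written $\Delta_m(z^{-1})$ in the literature, with the
  powers $z^{m_i}$ on the diagonal.\<close>

definition delay_matrix :: "nat ^ 'n \<Rightarrow> complex \<Rightarrow> complex ^ 'n ^ 'n" where
  "delay_matrix m z = diag (\<chi> i. z ^ (m $ i))"

text \<open>The transfer function is meaningful away from the system poles only: elsewhere
  \<open>matrix_inv\<close> is unspecified.\<close>

definition transfer_function :: "('n::finite, 'm::finite) fdn \<Rightarrow> complex \<Rightarrow> complex ^ 'm ^ 'm" where
  "transfer_function F z =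
     map_matrix of_real (output_gain F)
       ** matrix_inv (delay_matrix (delays F) z - map_matrix of_real (feedback F))
       ** map_matrix of_real (input_gain F)
     + map_matrix of_real (direct_gain F)"

definition gen_char_poly :: "nat ^ 'n \<Rightarrow> real ^ 'n ^ 'n \<Rightarrow> complex \<Rightarrow> complex" where
  "gen_char_poly m A z = det (delay_matrix m z - map_matrix of_real A)"

definition system_poles :: "('n::finite, 'm::finite) fdn \<Rightarrow> complex set" where
  "system_poles F = {z. gen_char_poly (delays F) (feedback F) z = 0}"

definition fdn_stable :: "('n::finite, 'm::finite) fdn \<Rightarrow> bool" where
  "fdn_stable F \<longleftrightarrow> (\<forall>z \<in> system_poles F. norm z < 1)"

end

(* For a singular pencil, v in its kernel and w = T^(-1) v, the matrix K = T^(-1) A T satisfies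
   K w = diag(z^m) w, because the diagonal matrices T and diag(z^m) commute. If |z| >= 1 the
   right-hand side is at least as long as w, while K, acting on real and imaginary parts
   separately, is a strict contraction. *)
theory Submission
  imports Defs
begin

lemma matrix_mult_diag_component:
  fixes A :: "'a::semiring_1 ^ 'n ^ 'm"
  shows "(A ** diag d) $ i $ j = A $ i $ j * d $ j"
  by (simp add: matrix_matrix_mult_def diag_def if_distrib cong: if_cong)

lemma diag_mult_matrix_component:
  fixes A :: "'a::semiring_1 ^ 'n ^ 'm"
  shows "(diag d ** A) $ i $ j = d $ i * A $ i $ j"
  by (simp add: matrix_matrix_mult_def diag_def if_distrib if_distribR cong: if_cong)

lemma diag_mult_vector_component:
  fixes d v :: "'a::semiring_1 ^ 'n"
  shows "(diag d *v v) $ i = d $ i * v $ i"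
  by (simp add: matrix_vector_mult_def diag_def if_distrib if_distribR cong: if_cong)

lemma invertible_diag_nonzero:
  fixes d :: "'a::field ^ 'n"
  assumes "invertible (diag d)"
  shows "d $ i \<noteq> 0"
proof -
  obtain X where "diag d ** X = mat 1"
    using assms unfolding invertible_def by blast
  then have "(diag d ** X) $ i $ i = 1"
    by (simp add: mat_def)
  then show ?thesis
    by (auto simp: diag_mult_matrix_component)
qed

text \<open>\<open>matrix_inv\<close> is a Hilbert choice, so invertibility is what gives it its
  defining property.\<close>

lemma matrix_mult_matrix_inv:
  fixes X :: "'a::semiring_1 ^ 'n ^ 'm"
  assumes "invertible X"
  shows "X ** matrix_inv X = mat 1"
  using someI_ex[OF assms[unfolded invertible_def]] unfolding matrix_inv_def by blast

lemma op_norm_less_1_imp_norm_less: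
  fixes K :: "real ^ 'n ^ 'm"
  assumes "op_norm K < 1" "x \<noteq> 0"
  shows "norm (K *v x) < norm x"
proof -
  have "norm (K *v x) \<le> op_norm K * norm x"
    by (rule onorm) (rule matrix_vector_mul_bounded_linear)
  also have "\<dots> < norm x"
    using assms by simp
  finally show ?thesis .
qed

text \<open>\<open>op_norm\<close> only sees real vectors, whereas the kernel vectors of the pencil
  are complex. Since K has real entries, the real and imaginary parts of its value at w are the
  images of those of w, and squared norms add over the two parts.\<close>

lemma op_norm_less_1_imp_norm_less_complex:
  fixes K :: "real ^ 'n ^ 'm" and w :: "complex ^ 'n"
  assumes "op_norm K < 1" "w \<noteq> 0"
  shows "norm (map_matrix of_real K *v w) < norm w"
proof -
  define x where "x = (\<chi> j. Re (w $ j))"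
  define y where "y = (\<chi> j. Im (w $ j))"
  have split: "(norm w)\<^sup>2 = (norm x)\<^sup>2 + (norm y)\<^sup>2"
    by (simp add: norm_vec_def L2_set_def sum_nonneg x_def y_def cmod_power2 sum.distrib)
  have "(norm (map_matrix of_real K *v w))\<^sup>2 = (norm (K *v x))\<^sup>2 + (norm (K *v y))\<^sup>2"
    by (simp add: norm_vec_def L2_set_def sum_nonneg x_def y_def cmod_power2 sum.distrib
        matrix_vector_mult_def)
  also have "\<dots> < (norm x)\<^sup>2 + (norm y)\<^sup>2"
  proof -
    \<comment> \<open>One of x and y may vanish, so the strict bound is available for at least one
      of them and the weak bound covers the other.\<close>
    have le: "(norm (K *v u))\<^sup>2 \<le> (norm u)\<^sup>2" for u
      using op_norm_less_1_imp_norm_less[OF assms(1), of u]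
      by (cases "u = 0") (auto intro: power_mono)
    have less: "(norm (K *v u))\<^sup>2 < (norm u)\<^sup>2" if "u \<noteq> 0" for u
      using op_norm_less_1_imp_norm_less[OF assms(1) that] by (intro power_strict_mono) auto
    have "x \<noteq> 0 \<or> y \<noteq> 0"
      using split assms(2) by fastforce
    then show ?thesis
      using le less by (meson add_less_le_mono add_le_less_mono)
  qed
  finally show ?thesis
    unfolding split[symmetric] by (rule power_less_imp_less_base) simp
qed

theorem theorem2:
  fixes m :: "nat ^ 'n"
    and A :: "real ^ 'n ^ 'n"
    and B :: "real ^ 'm ^ 'n"
    and C :: "real ^ 'n ^ 'm"
    and D :: "real ^ 'm ^ 'm"
  assumes "\<And>i. m $ i > 0"
    and "\<exists>T :: real ^ 'n ^ 'n. diagonal_matrix T \<and> invertible T \<and>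
           op_norm (matrix_inv T ** A ** T) < 1"
  shows "fdn_stable \<lparr>delays = m, feedback = A, input_gain = B, output_gain = C, direct_gain = D\<rparr>"
proof -
  obtain d :: "real ^ 'n" where inv: "invertible (diag d)"
    and contr: "op_norm (matrix_inv (diag d) ** A ** diag d) < 1"
    using assms(2) unfolding diagonal_matrix_def by blast
  define K where "K = matrix_inv (diag d) ** A ** diag d"
  have d: "d $ i \<noteq> 0" for i
    using inv by (rule invertible_diag_nonzero)
  \<comment> \<open>Clearing the inverse this way lets the entries of K be read off without
    computing \<open>matrix_inv (diag d)\<close>.\<close>
  have "diag d ** K = A ** diag d"
    by (simp add: K_def matrix_mul_assoc matrix_mult_matrix_inv[OF inv])
  then have K: "K $ i $ j = A $ i $ j * d $ j / d $ i" for i j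
    using d[of i] diag_mult_matrix_component[of d K i j] matrix_mult_diag_component[of A d i j]
    by (simp add: field_simps)
  have "norm z < 1" if "det (delay_matrix m z - map_matrix of_real A) = 0" for z
  proof (rule ccontr)
    assume z: "\<not> norm z < 1"
    from that obtain v where v: "v \<noteq> 0" "(delay_matrix m z - map_matrix of_real A) *v v = 0"
      using invertible_det_nz invertible_left_inverse matrix_left_invertible_ker by metis
    define w where "w = (\<chi> i. v $ i / of_real (d $ i))"
    have "w \<noteq> 0"
      using v(1) d by (auto simp: w_def vec_eq_iff)
    have "(map_matrix of_real K *v w) $ i = z ^ (m $ i) * w $ i" for i
    proof -
      \<comment> \<open>The factor d_j in the entry K_ij cancels the denominator of w_j, and 1/d_i
        leaves the sum.\<close>
      have "(map_matrix of_real K *v w) $ i = (map_matrix of_real A *v v) $ i / of_real (d $ i)"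
        using d by (simp add: matrix_vector_mult_def K w_def sum_divide_distrib)
      also have "map_matrix of_real A *v v = delay_matrix m z *v v"
        using v(2) by (simp add: matrix_vector_mult_diff_rdistrib)
      finally show ?thesis
        by (simp add: delay_matrix_def diag_mult_vector_component w_def)
    qed
    \<comment> \<open>Each factor z^(m_i) has modulus at least 1 because |z| \<ge> 1, so the lengths
      compare entry by entry.\<close>
    then have "norm (w $ i) \<le> norm ((map_matrix of_real K *v w) $ i)" for i
      using z by (simp add: norm_mult norm_power mult_le_cancel_right1 one_le_power)
    then have "norm w \<le> norm (map_matrix of_real K *v w)"
      by (rule norm_le_componentwise_cart)
    with op_norm_less_1_imp_norm_less_complex[of K w] contr \<open>w \<noteq> 0\<close> show False
      by (simp add: K_def)
  qed
  then show ?thesis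
    by (simp add: fdn_stable_def system_poles_def gen_char_poly_def)
qed

end
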